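(* Let $\mathcal{S}=\{\pm1\pm i\}$ be the 4-PSK constellation, let $\mathcal{H}$ be the set of singular fade states for two-way ACF relaying with signal set $\mathcal{S}$ at both end nodes, and let $\mathcal{C}^{\mathcal{H}}=\{\mathcal{C}^h : h\in\mathcal{H}\}$ be the chosen set of clusterings, $\mathcal{C}^h$ removing $h$. Let $\gamma e^{j\theta}$ be a fade state and let $(\mathsf{x_A},\mathsf{x_B})\neq(\mathsf{x'_A},\mathsf{x'_B})$ in $\mathcal{S}^2$ be such that $h^*:=-\frac{\mathsf{x_A}-\mathsf{x'_A}}{\mathsf{x_B}-\mathsf{x'_B}}$ is an element of $\mathcal{H}$ (so that $\mathcal{C}^{h^*}\in\mathcal{C}^{\mathcal{H}}$) and $$\arg\min_{(x_A,x_B)\neq(x'_A,x'_B)\in\mathcal{S}^2}\left|(x_A-x'_A)+\gamma e^{j\theta}(x_B-x'_B)\right|=(\mathsf{x_A},\mathsf{x_B},\mathsf{x'_A},\mathsf{x'_B}).$$ Then $h^*$ maximizes $d_{min}^2(\mathcal{C}^h,\gamma e^{j\theta})$ among all $h\in\mathcal{H}$.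
   Context: A fade state is a complex number $z=\gamma e^{j\theta}$ with $\gamma>0$, $j=\sqrt{-1}$. In ACF relaying, A transmits $x_{A_1},x_{A_2}\in\mathcal{S}$ and B transmits $x_{B_1},x_{B_2}\in\mathcal{S}$ over two channel uses with the same fade state, and the relay sees $(x_{A_1}+zx_{B_1},\,x_{A_2}+zx_{B_2})$. The set $\mathcal{H}$ of singular fade states consists of those $z$ for which the set of these points, over all choices in $\mathcal{S}^4$, has fewer than $4^4$ elements. A clustering $\mathcal{C}$ is a partition of $\mathcal{S}^4$ (elements written $((x_{A_1},x_{B_1}),(x_{A_2},x_{B_2}))$) satisfying the exclusive law: two distinct elements having the same $(x_{A_1},x_{A_2})$, or having the same $(x_{B_1},x_{B_2})$, lie in different clusters. The minimum cluster distance of $\mathcal{C}$ at a fade state $z$ is defined by $$d_{min}^2(\mathcal{C},z)=\min\left\{|(x_{A_1}-x'_{A_1})+z(x_{B_1}-x'_{B_1})|^2+|(x_{A_2}-x'_{A_2})+z(x_{B_2}-x'_{B_2})|^2\right\},$$ the minimum being over all pairs of elements $((x_{A_1},x_{B_1}),(x_{A_2},x_{B_2}))$, $((x'_{A_1},x'_{B_1}),(x'_{A_2},x'_{B_2}))$ of $\mathcal{S}^4$ lying in different clusters of $\mathcal{C}$. A clustering removes $h\in\mathcal{H}$ if $d_{min}(\mathcal{C},h)>0$. For each $h\in\mathcal{H}$, $\mathcal{C}^h$ denotes a clustering which removes $h$ (if several clusterings remove $h$, any one of them is chosen), and $\mathcal{C}^{\mathcal{H}}=\{\mathcal{C}^h:h\in\mathcal{H}\}$.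 The argmin hypothesis means that the displayed tuple attains the minimum. *)

theory Defs
  imports Complex_Main "HOL-Library.Disjoint_Sets"
begin

definition psk4 :: "complex set" where
  "psk4 = {1 + \<i>, 1 - \<i>, - 1 + \<i>, - 1 - \<i>}"

definition fade_state :: "complex \<Rightarrow> bool" where
  "fade_state z \<longleftrightarrow> (\<exists>\<gamma> \<theta> :: real. \<gamma> > 0 \<and> z = of_real \<gamma> * exp (\<i> * of_real \<theta>))"

text \<open>Quadruples are grouped by channel use, \<open>((x\<^sub>A\<^sub>1, x\<^sub>B\<^sub>1), (x\<^sub>A\<^sub>2, x\<^sub>B\<^sub>2))\<close>,
  not by end node.\<close>

type_synonym quad = "(complex \<times> complex) \<times> (complex \<times> complex)"

definition quads :: "quad set" where
  "quads = (psk4 \<times> psk4) \<times> (psk4 \<times> psk4)"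

definition relay_points :: "complex \<Rightarrow> (complex \<times> complex) set" where
  "relay_points z = {(xA1 + z * xB1, xA2 + z * xB2) | xA1 xB1 xA2 xB2.
     ((xA1, xB1), (xA2, xB2)) \<in> quads}"

text \<open>Since \<open>0\<close> is not a fade state, it is not singular. Consequently, with the convention
  \<open>x / 0 = 0\<close>, a membership \<open>- (a / b) \<in> singular_fade_states\<close> forces \<open>b \<noteq> 0\<close>.\<close>

definition singular_fade_states :: "complex set" where
  "singular_fade_states = {z. fade_state z \<and> card (relay_points z) < 4 ^ 4}"

definition exclusive_law :: "quad set set \<Rightarrow> bool" where
  "exclusive_law C \<longleftrightarrow>
     (\<forall>K\<in>C. \<forall>xA1 xB1 xA2 xB2 yA1 yB1 yA2 yB2.
        ((xA1, xB1), (xA2, xB2)) \<in> K \<longrightarrow> ((yA1, yB1), (yA2, yB2)) \<in> K \<longrightarrow>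
        ((xA1, xB1), (xA2, xB2)) \<noteq> ((yA1, yB1), (yA2, yB2)) \<longrightarrow>
        (xA1, xA2) \<noteq> (yA1, yA2) \<and> (xB1, xB2) \<noteq> (yB1, yB2))"

definition clustering :: "quad set set \<Rightarrow> bool" where
  "clustering C \<longleftrightarrow> partition_on quads C \<and> exclusive_law C"

definition different_clusters :: "quad set set \<Rightarrow> quad \<Rightarrow> quad \<Rightarrow> bool" where
  "different_clusters C p q \<longleftrightarrow> (\<exists>K\<in>C. \<exists>L\<in>C. K \<noteq> L \<and> p \<in> K \<and> q \<in> L)"

fun dist_sq :: "complex \<Rightarrow> quad \<Rightarrow> quad \<Rightarrow> real" where
  "dist_sq z ((xA1, xB1), (xA2, xB2)) ((yA1, yB1), (yA2, yB2)) =
     (cmod ((xA1 - yA1) + z * (xB1 - yB1)))\<^sup>2 + (cmod ((xA2 - yA2) + z * (xB2 - yB2)))\<^sup>2"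

text \<open>For a clustering, the set below is finite, and it is nonempty because the exclusive law
  rules out a single cluster; so \<open>Min\<close> is a genuine minimum.\<close>

definition dmin_sq :: "quad set set \<Rightarrow> complex \<Rightarrow> real" where
  "dmin_sq C z = Min {dist_sq z p q | p q. different_clusters C p q}"

definition dmin :: "quad set set \<Rightarrow> complex \<Rightarrow> real" where
  "dmin C z = sqrt (dmin_sq C z)"

definition removes :: "quad set set \<Rightarrow> complex \<Rightarrow> bool" where
  "removes C h \<longleftrightarrow> dmin C h > 0"

end

(*
  For a fade state z, call a difference (a, b) of points of S^2 short if |a + z b| <= M. If every
  pair of points with a short difference were clustered together, with the second channel use held
  fixed, the exclusive law would force M < 2 and M < 2 |z|. Then -a/b lies in the same closed
  quadrant as z, so it is one of u, v, u + v, (u + v)/2 for a real unit u and an imaginary unit v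
  determined by z. If two of these four ratios occur, a chain of two or three short steps joins two
  points of S^2 that agree in exactly one coordinate, against the exclusive law. So two
  non-proportional differences of size at most M force d_min(C, z) <= M for every clustering C.

  In the theorem, let p, q be a pair attaining d_min for the clustering of h*. It is not at
  distance 0 for h*, so in one of the two uses its difference is not proportional to the argmin
  difference, which is at least as short. The bound then applies to every clustering.
*)
theory Submission
  imports Defs
begin

section \<open>Differences of 4-PSK points and their ratios\<close>

lemma psk4_diff_cases:
  assumes "x \<in> psk4" "y \<in> psk4" "x \<noteq> y"
  shows "x - y \<in> {2, -2, 2 * \<i>, -2 * \<i>, 2 + 2 * \<i>, 2 - 2 * \<i>, -2 + 2 * \<i>, -2 - 2 * \<i>}"
  using assms unfolding psk4_def by (elim insertE emptyE) (simp_all add: complex_eq_iff)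

text \<open>The second case is the ratio \<open>s / 2 = 1 / cnj s\<close>, written so that the bound below is
  again \<open>2 * cmod _\<close>.\<close>

lemma psk4_ratio_cases:
  assumes "x \<in> psk4" "x' \<in> psk4" "x \<noteq> x'" "y \<in> psk4" "y' \<in> psk4" "y \<noteq> y'"
  obtains h where "x - x' = - h * (y - y')"
      "h \<in> {1, -1, \<i>, -\<i>, 1 + \<i>, 1 - \<i>, -1 + \<i>, -1 - \<i>}" "2 \<le> cmod (y - y')"
    | s where "cnj s * (x - x') = - (y - y')" "s \<in> {1 + \<i>, 1 - \<i>, -1 + \<i>, -1 - \<i>}"
      "cmod (x - x') = 2"
proof -
  \<comment> \<open>Axis differences \<open>?U\<close> have modulus 2, diagonal ones
    \<open>?V\<close> modulus 2 * sqrt 2. Two of the same kind have a unit ratio, diagonal over axis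
    gives a point of \<open>psk4\<close>, axis over diagonal the inverse of one.\<close>
  let ?U = "{2, -2, 2 * \<i>, -2 * \<i>}"
  let ?V = "{2 + 2 * \<i>, 2 - 2 * \<i>, -2 + 2 * \<i>, -2 - 2 * \<i>}"
  have same: "- a / b \<in> {1, -1, \<i>, -\<i>}" if "a \<in> ?U \<and> b \<in> ?U \<or> a \<in> ?V \<and> b \<in> ?V" for a b
    using that
    by (elim insertE emptyE disjE conjE) (simp_all add: complex_eq_iff Re_divide Im_divide)
  have mixed: "- a / b \<in> {1 + \<i>, 1 - \<i>, -1 + \<i>, -1 - \<i>}" if "a \<in> ?V" "b \<in> ?U" for a b
    using that by (elim insertE emptyE) (simp_all add: complex_eq_iff Re_divide Im_divide)
  have cnj_mem: "cnj c \<in> {1 + \<i>, 1 - \<i>, -1 + \<i>, -1 - \<i>}"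
    if "c \<in> {1 + \<i>, 1 - \<i>, -1 + \<i>, -1 - \<i>}" for c
    using that by (elim insertE emptyE) (simp_all add: complex_eq_iff)
  define a b where "a = x - x'" and "b = y - y'"
  have a: "a \<in> ?U \<or> a \<in> ?V" and b: "b \<in> ?U \<or> b \<in> ?V"
    using psk4_diff_cases[OF assms(1-3)] psk4_diff_cases[OF assms(4-6)]
    unfolding a_def b_def by blast+
  have ne: "a \<noteq> 0" "b \<noteq> 0" using assms(3,6) by (simp_all add: a_def b_def)
  show ?thesis
  proof (cases "a \<in> ?U \<and> b \<in> ?V")
    case True
    then have "cmod a = 2" by (elim conjE insertE emptyE) (simp_all add: norm_mult)
    moreover have "cnj (- b / a) \<in> {1 + \<i>, 1 - \<i>, -1 + \<i>, -1 - \<i>}"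
      using mixed[of b a] True cnj_mem by blast
    ultimately show ?thesis
      using that(2)[of "cnj (- b / a)"] ne unfolding a_def b_def by simp
  next
    case False
    then have "- a / b \<in> {1, -1, \<i>, -\<i>, 1 + \<i>, 1 - \<i>, -1 + \<i>, -1 - \<i>}"
      using same[of a b] mixed[of a b] a b by blast
    moreover have "2 \<le> cmod b"
      using b by (elim disjE insertE emptyE) (simp_all add: cmod_def real_le_rsqrt)
    ultimately show ?thesis
      using that(1)[of "- a / b"] ne unfolding a_def b_def by simp
  qed
qed

text \<open>Factoring out \<open>y - y'\<close> or \<open>x - x'\<close>, of modulus at least 2,
  bounds \<open>h - z\<close> or \<open>1 - cnj s * z\<close> by half of \<open>M\<close>. As this
  is less than 1 and less than \<open>cmod z\<close>, the ratio falls in the closed quadrant of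
  \<open>z\<close>, whose bounding rays pass through \<open>u\<close> and \<open>v\<close>.\<close>

lemma short_ratio_cases:
  fixes z :: complex
  assumes psk: "x \<in> psk4" "x' \<in> psk4" "y \<in> psk4" "y' \<in> psk4" and ne: "(x, y) \<noteq> (x', y')"
    and le: "cmod ((x - x') + z * (y - y')) \<le> M" and M: "M < 2" "M < 2 * cmod z"
    and u: "u = (if Re z \<ge> 0 then 1 else -1)" and v: "v = (if Im z \<ge> 0 then \<i> else -\<i>)"
  shows "(\<exists>h\<in>{u, v, u + v}. x - x' = - h * (y - y') \<and> 2 * cmod (h - z) \<le> M) \<or>
    cnj (u + v) * (x - x') = - (y - y') \<and> 2 * cmod (1 - cnj (u + v) * z) \<le> M"
proof -
  have squares: "2 * t - 1 \<le> t^2" "- 2 * t - 1 \<le> t^2" "0 \<le> t^2" for t :: real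
    using zero_le_power2[of "t - 1"] zero_le_power2[of "t + 1"]
    by (simp_all add: power2_diff power2_sum)
  have diff_ge: "2 \<le> cmod (p - q)" if "p \<in> psk4" "q \<in> psk4" "p \<noteq> q" for p q
    using psk4_diff_cases[OF that]
    by (elim insertE emptyE) (simp_all add: cmod_def real_le_rsqrt)
  have "x \<noteq> x'"
  proof
    assume "x = x'"
    then have "2 * cmod z \<le> cmod (z * (y - y'))"
      using diff_ge[of y y'] psk ne
      mult_left_mono[of 2 "cmod (y - y')" "cmod z"] by (simp add: norm_mult mult.commute)
    with le M \<open>x = x'\<close> show False by simp
  qed
  moreover have "y \<noteq> y'"
    using diff_ge[of x x'] psk le M ne by force
  ultimately show ?thesis
  proof (rule psk4_ratio_cases[OF psk(1,2) _ psk(3,4)])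
    fix h assume h: "x - x' = - h * (y - y')"
      "h \<in> {1, -1, \<i>, -\<i>, 1 + \<i>, 1 - \<i>, -1 + \<i>, -1 - \<i>}" "2 \<le> cmod (y - y')"
    have "(x - x') + z * (y - y') = (z - h) * (y - y')"
      using h(1) by (simp add: algebra_simps)
    then have "cmod ((x - x') + z * (y - y')) = cmod (h - z) * cmod (y - y')"
      by (simp add: norm_mult norm_minus_commute)
    also have "\<dots> \<ge> 2 * cmod (h - z)"
      using mult_left_mono[OF h(3), of "cmod (h - z)"] by simp
    finally have near: "2 * cmod (h - z) \<le> M" using le by linarith
    then have "cmod (h - z) ^ 2 < 1" "cmod (h - z) ^ 2 < cmod z ^ 2"
      using M by (auto simp: power_less_one_iff intro!: power_strict_mono)
    \<comment> \<open>A nonzero coordinate of \<open>h\<close> is 1 or -1. If that coordinate of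
      \<open>z\<close> were 0 or of opposite sign, it alone would give
      \<open>cmod (h - z) \<ge> 1\<close>.\<close>
    then have "Re h = 0 \<or> 0 < Re h * Re z" "Im h = 0 \<or> 0 < Im h * Im z"
      using h(2) unfolding cmod_power2
      by (elim insertE emptyE; simp add: power2_diff; insert squares[of "Re z"] squares[of "Im z"]; linarith)+
    \<comment> \<open>The inequalities are strict, so a vanishing coordinate of \<open>z\<close>
      makes that of \<open>h\<close> vanish too, and the sign chosen for \<open>u\<close> or
      \<open>v\<close> there is harmless.\<close>
    then have "h \<in> {u, v, u + v}"
      using h(2) unfolding u v by (elim insertE emptyE) auto
    with h(1) near show ?thesis by blast
  next
    fix s assume s: "cnj s * (x - x') = - (y - y')" "s \<in> {1 + \<i>, 1 - \<i>, -1 + \<i>, -1 - \<i>}"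
      "cmod (x - x') = 2"
    have "(x - x') + z * (y - y') = (1 - cnj s * z) * (x - x')"
    proof -
      have "y - y' = - (cnj s * (x - x'))" using s(1) by (metis minus_minus)
      show ?thesis unfolding \<open>y - y' = _\<close> by (simp add: algebra_simps)
    qed
    then have near: "2 * cmod (1 - cnj s * z) \<le> M"
      using s(3) le by (simp add: norm_mult mult.commute)
    then have "cmod (1 - cnj s * z) ^ 2 < 1" "cmod (1 - cnj s * z) ^ 2 < cmod z ^ 2"
      using M by (auto simp: power_less_one_iff intro!: power_strict_mono)
    moreover have "cmod (1 - cnj s * z) ^ 2 =
        1 - 2 * (Re s * Re z + Im s * Im z) + 2 * ((Re z)^2 + (Im z)^2)"
      using s(2) unfolding cmod_power2
      by (elim insertE emptyE; hypsubst; simp add: power2_eq_square algebra_simps)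
    \<comment> \<open>With p = \<open>Re s * Re z\<close> and q = \<open>Im s * Im z\<close>, the
      second bound reads (p - 1)^2 + (q - 1)^2 < 1.\<close>
    ultimately have "0 < Re s * Re z" "0 < Im s * Im z"
      using s(2) unfolding cmod_power2
      by (elim insertE emptyE; simp; insert squares[of "Re z"] squares[of "Im z"]; linarith)+
    then have "s = u + v"
      using s(2) unfolding u v by (elim insertE emptyE) auto
    with s(1) near show ?thesis by blast
  qed
qed

section \<open>Chains of short steps\<close>

text \<open>\<open>R\<close> models sharing a cluster while the second channel use is fixed. A ratio
  \<open>h\<close> permits displacements \<open>(2 * c * h, - 2 * c)\<close>, a half ratio
  \<open>(2 * c, - 2 * c * cnj s)\<close>, for units \<open>c\<close>. In each chain the units make
  exactly one coordinate of the total displacement cancel.\<close>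

lemma no_two_short_ratios:
  fixes R :: "complex \<times> complex \<Rightarrow> complex \<times> complex \<Rightarrow> bool"
  assumes trans: "\<And>p q r. R p q \<Longrightarrow> R q r \<Longrightarrow> R p r"
    and excl: "\<And>x y y'. R (x, y) (x, y') \<Longrightarrow> y = y'" "\<And>x x' y. R (x, y) (x', y) \<Longrightarrow> x = x'"
    and step: "\<And>x x' y y'. {x, x', y, y'} \<subseteq> psk4 \<Longrightarrow>
      cmod ((x - x') + z * (y - y')) \<le> M \<Longrightarrow> R (x, y) (x', y')"
    and u: "u \<in> {1, -1}" and v: "v \<in> {\<i>, -\<i>}"
  defines "near \<equiv> \<lambda>h. 2 * cmod (h - z) \<le> M"
    and "near_half \<equiv> \<lambda>s. 2 * cmod (1 - cnj s * z) \<le> M"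
  shows "\<not> (near u \<and> near v)" "\<not> (near u \<and> near (u + v))" "\<not> (near v \<and> near (u + v))"
    "\<not> (near_half (u + v) \<and> near u)" "\<not> (near_half (u + v) \<and> near v)"
    "\<not> (near_half (u + v) \<and> near (u + v))"
proof -
  have near_step: "R (x, y) (x', y')"
    if "near h" "{x, x', y, y'} \<subseteq> psk4" "x' - x = 2 * c * h" "y' - y = - 2 * c" "cmod c = 1"
    for h c x x' y y'
  proof (rule step)
    have "(x - x') + z * (y - y') = - (2 * c * (h - z))"
      using that(3,4) by algebra
    then show "cmod ((x - x') + z * (y - y')) \<le> M"
      using that(1,5) by (simp only: norm_minus_cancel norm_mult) (simp add: near_def)
  qed (use that in blast)
  have half_step: "R (x, y) (x', y')"
    if "near_half s" "{x, x', y, y'} \<subseteq> psk4" "x' - x = 2 * c" "y' - y = - 2 * c * cnj s" "cmod c = 1"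
    for s c x x' y y'
  proof (rule step)
    have "(x - x') + z * (y - y') = - (2 * c * (1 - cnj s * z))"
      using that(3,4) by algebra
    then show "cmod ((x - x') + z * (y - y')) \<le> M"
      using that(1,5) by (simp only: norm_minus_cancel norm_mult) (simp add: near_half_def)
  qed (use that in blast)
  have unit: "cmod u = 1" "cmod v = 1" "u * u = 1" "v * v = -1" "cnj u = u" "cnj v = - v"
      "u \<noteq> v" "u \<noteq> - v"
    using u v by (auto simp: complex_eq_iff cmod_def)
  have mem: "1 + \<i> \<in> psk4" "-1 + \<i> \<in> psk4" "1 - \<i> \<in> psk4" "-1 - \<i> \<in> psk4"
      "u + v \<in> psk4" "u - v \<in> psk4" "-u + v \<in> psk4" "-u - v \<in> psk4"
      "1 + u * v \<in> psk4" "1 - u * v \<in> psk4" "-1 + u * v \<in> psk4" "-1 - u * v \<in> psk4"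
    using u v unfolding psk4_def by auto
  show "\<not> (near u \<and> near v)"
  proof
    assume "near u \<and> near v"
    \<comment> \<open>The displacements \<open>(2 * u, -2)\<close> and \<open>(- 2 * v, 2)\<close>
      leave the second coordinate unchanged.\<close>
    then have "R (-u + v, 1 + \<i>) (u + v, -1 + \<i>)" "R (u + v, -1 + \<i>) (u - v, 1 + \<i>)"
      using near_step[of u "-u + v" "u + v" "1 + \<i>" "-1 + \<i>" 1]
        near_step[of v "u + v" "u - v" "-1 + \<i>" "1 + \<i>" "-1"] mem by simp_all
    from excl(2)[OF trans[OF this]] have "u = v" by (simp add: algebra_simps)
    with unit show False by simp
  qed
  show "\<not> (near u \<and> near (u + v))"
  proof
    assume "near u \<and> near (u + v)"
    then have "R (-u - v, 1 + \<i>) (u + v, -1 + \<i>)" "R (u + v, -1 + \<i>) (-u + v, 1 + \<i>)"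
      using near_step[of "u + v" "-u - v" "u + v" "1 + \<i>" "-1 + \<i>" 1]
        near_step[of u "u + v" "-u + v" "-1 + \<i>" "1 + \<i>" "-1"] mem by simp_all
    from excl(2)[OF trans[OF this]] unit show False by auto
  qed
  show "\<not> (near v \<and> near (u + v))"
  proof
    assume "near v \<and> near (u + v)"
    then have "R (-u - v, 1 + \<i>) (u + v, -1 + \<i>)" "R (u + v, -1 + \<i>) (u - v, 1 + \<i>)"
      using near_step[of "u + v" "-u - v" "u + v" "1 + \<i>" "-1 + \<i>" 1]
        near_step[of v "u + v" "u - v" "-1 + \<i>" "1 + \<i>" "-1"] mem by simp_all
    from excl(2)[OF trans[OF this]] unit show False by auto
  qed
  show "\<not> (near_half (u + v) \<and> near u)"
  proof
    assume "near_half (u + v) \<and> near u"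
    \<comment> \<open>The unit \<open>-u\<close> gives \<open>2 * (-u) * u = -2\<close>, undoing the
      first displacement 2. For \<open>v\<close> the unit is \<open>v\<close> itself, since
      \<open>v * v = -1\<close>.\<close>
    then have "R (-1 + \<i>, u - v) (1 + \<i>, -u + v)" "R (1 + \<i>, -u + v) (-1 + \<i>, u + v)"
      using half_step[of "u + v" "-1 + \<i>" "1 + \<i>" "u - v" "-u + v" 1]
        near_step[of u "1 + \<i>" "-1 + \<i>" "-u + v" "u + v" "-u"] mem unit by simp_all
    from excl(1)[OF trans[OF this]] unit show False by auto
  qed
  show "\<not> (near_half (u + v) \<and> near v)"
  proof
    assume "near_half (u + v) \<and> near v"
    then have "R (-1 + \<i>, u - v) (1 + \<i>, -u + v)" "R (1 + \<i>, -u + v) (-1 + \<i>, -u - v)"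
      using half_step[of "u + v" "-1 + \<i>" "1 + \<i>" "u - v" "-u + v" 1]
        near_step[of v "1 + \<i>" "-1 + \<i>" "-u + v" "-u - v" v] mem unit by simp_all
    from excl(1)[OF trans[OF this]] unit show False by auto
  qed
  show "\<not> (near_half (u + v) \<and> near (u + v))"
  proof
    assume "near_half (u + v) \<and> near (u + v)"
    moreover have "v * (v * 2) = - 2" using unit by (simp flip: mult.assoc)
    \<comment> \<open>Two half steps, with units \<open>-u\<close> and \<open>-v\<close>, cancel the
      first displacement \<open>2 * (u + v)\<close> of the full step; the second displacements add
      up to 2.\<close>
    ultimately have "R (u - v, -1 + u * v) (-u - v, 1 - u * v)" "R (-u - v, 1 - u * v) (u + v, -1 - u * v)"
        "R (u + v, -1 - u * v) (u - v, 1 + u * v)"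
      using half_step[of "u + v" "u - v" "-u - v" "-1 + u * v" "1 - u * v" "-u"]
        near_step[of "u + v" "-u - v" "u + v" "1 - u * v" "-1 - u * v" 1]
        half_step[of "u + v" "u + v" "u - v" "-1 - u * v" "1 + u * v" "-v"] mem unit
        \<open>v * (v * 2) = - 2\<close>
      by (simp_all add: algebra_simps)
    from excl(1)[OF trans[OF trans[OF this(1,2)] this(3)]] show False by simp
  qed
qed

section \<open>Bounding the minimum cluster distance\<close>

lemma different_clustersI:
  assumes "clustering C" "p \<in> quads" "q \<in> quads" "\<not> (\<exists>K\<in>C. p \<in> K \<and> q \<in> K)"
  shows "different_clusters C p q"
proof -
  have "\<Union> C = quads" using assms(1) by (simp add: clustering_def partition_on_def)
  then obtain K L where "K \<in> C" "p \<in> K" "L \<in> C" "q \<in> L" using assms(2,3) by blast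
  with assms(4) show ?thesis unfolding different_clusters_def by blast
qed

lemma
  assumes "clustering C"
  shows dmin_sq_le: "different_clusters C p q \<Longrightarrow> dmin_sq C z \<le> dist_sq z p q"
    and dmin_sq_attained: "\<exists>p q. different_clusters C p q \<and> dmin_sq C z = dist_sq z p q"
proof -
  let ?D = "{dist_sq z p q | p q. different_clusters C p q}"
  have "different_clusters C p q \<Longrightarrow> p \<in> quads \<and> q \<in> quads" for p q
    using assms unfolding clustering_def different_clusters_def partition_on_def by blast
  then have "?D \<subseteq> (\<lambda>(p, q). dist_sq z p q) ` (quads \<times> quads)" by blast
  moreover have "finite quads" by (simp add: quads_def psk4_def)
  ultimately have fin: "finite ?D" by (meson finite_SigmaI finite_imageI finite_subset)
  show "different_clusters C p q \<Longrightarrow> dmin_sq C z \<le> dist_sq z p q"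
    unfolding dmin_sq_def using fin by (intro Min_le) blast+
  \<comment> \<open>This pair agrees in both A symbols, so the exclusive law separates it and the
    minimum is over a nonempty set.\<close>
  have "different_clusters C ((1 + \<i>, 1 + \<i>), (1 + \<i>, 1 + \<i>)) ((1 + \<i>, 1 - \<i>), (1 + \<i>, 1 + \<i>))"
  proof (rule different_clustersI[OF assms])
    show "\<not> (\<exists>K\<in>C. ((1 + \<i>, 1 + \<i>), (1 + \<i>, 1 + \<i>)) \<in> K \<and> ((1 + \<i>, 1 - \<i>), (1 + \<i>, 1 + \<i>)) \<in> K)"
      using assms unfolding clustering_def exclusive_law_def by (fastforce simp: complex_eq_iff)
  qed (simp_all add: quads_def psk4_def)
  then have "?D \<noteq> {}" by blast
  from Min_in[OF fin this] show "\<exists>p q. different_clusters C p q \<and> dmin_sq C z = dist_sq z p q"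
    unfolding dmin_sq_def by blast
qed

text \<open>Nothing ties \<open>C\<close> to a singular fade state, so the bound serves every
  competing clustering. Non-proportionality is stated as a nonzero determinant to avoid dividing by
  a vanishing difference.\<close>

lemma dmin_sq_le_nonproportional:
  assumes C: "clustering C" and psk: "{x, x', y, y', s, s', t, t'} \<subseteq> psk4"
    and le: "cmod ((x - x') + z * (y - y')) \<le> M" "cmod ((s - s') + z * (t - t')) \<le> M"
    and nonprop: "(x - x') * (t - t') \<noteq> (s - s') * (y - y')"
  shows "dmin_sq C z \<le> M\<^sup>2"
proof (rule ccontr)
  assume "\<not> dmin_sq C z \<le> M\<^sup>2"
  \<comment> \<open>With both second uses equal to \<open>w\<close>, \<open>dist_sq\<close> is a
    single square and the exclusive law concerns the first use alone.\<close>
  define w where "w = (1 + \<i>, 1 + \<i>)"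
  define R where "R p q \<longleftrightarrow> (\<exists>K\<in>C. (p, w) \<in> K \<and> (q, w) \<in> K)" for p q
  have w: "w \<in> psk4 \<times> psk4" by (simp add: w_def psk4_def)
  have "disjoint C" using C unfolding clustering_def partition_on_def by blast
  then have trans: "R p r" if "R p q" "R q r" for p q r
    using that unfolding R_def disjoint_def by blast
  have excl: "R (a, b) (a, b') \<Longrightarrow> b = b'" "R (a, b) (a', b) \<Longrightarrow> a = a'" for a a' b b'
    using C unfolding R_def clustering_def exclusive_law_def w_def by blast+
  have step: "R (a, b) (a', b')"
    if "{a, a', b, b'} \<subseteq> psk4" "cmod ((a - a') + z * (b - b')) \<le> M" for a a' b b'
  proof (rule ccontr)
    assume "\<not> R (a, b) (a', b')"
    then have "different_clusters C ((a, b), w) ((a', b'), w)"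
      using that(1) w by (intro different_clustersI[OF C]) (auto simp: R_def quads_def)
    from dmin_sq_le[OF C this, of z] power_mono[OF that(2), of 2] have "dmin_sq C z \<le> M\<^sup>2"
      by (simp add: w_def)
    with \<open>\<not> dmin_sq C z \<le> M\<^sup>2\<close> show False by simp
  qed
  have corners: "1 + \<i> \<in> psk4" "-1 + \<i> \<in> psk4" by (simp_all add: psk4_def)
  \<comment> \<open>Changing only A by 2 costs 2, changing only B by 2 costs
    \<open>2 * cmod z\<close>. If \<open>M\<close> reached either value, such a pair would share a
    cluster.\<close>
  have "M < 2"
  proof (rule ccontr)
    assume "\<not> M < 2"
    then have "R (1 + \<i>, 1 + \<i>) (-1 + \<i>, 1 + \<i>)" using corners by (intro step) auto
    from excl(2)[OF this] show False by (simp add: complex_eq_iff)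
  qed
  have "M < 2 * cmod z"
  proof (rule ccontr)
    assume "\<not> M < 2 * cmod z"
    then have "R (1 + \<i>, 1 + \<i>) (1 + \<i>, -1 + \<i>)"
      using corners by (intro step) (auto simp: norm_mult)
    from excl(1)[OF this] show False by (simp add: complex_eq_iff)
  qed
  define u v :: complex where "u = (if Re z \<ge> 0 then 1 else -1)" and "v = (if Im z \<ge> 0 then \<i> else -\<i>)"
  have uv: "u \<in> {1, -1}" "v \<in> {\<i>, -\<i>}" by (auto simp: u_def v_def)
  have "(x, y) \<noteq> (x', y')" "(s, t) \<noteq> (s', t')" using nonprop by auto
  note cases = short_ratio_cases[OF _ _ _ _ _ _ \<open>M < 2\<close> \<open>M < 2 * cmod z\<close> u_def v_def]
  let ?full = "\<lambda>h a b. a = - h * b \<and> 2 * cmod (h - z) \<le> M"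
  let ?half = "\<lambda>a b. cnj (u + v) * a = - b \<and> 2 * cmod (1 - cnj (u + v) * z) \<le> M"
  have 1: "(\<exists>h\<in>{u, v, u + v}. ?full h (x - x') (y - y')) \<or> ?half (x - x') (y - y')"
    using psk by (intro cases[OF _ _ _ _ \<open>(x, y) \<noteq> (x', y')\<close> le(1)]) auto
  have 2: "(\<exists>h\<in>{u, v, u + v}. ?full h (s - s') (t - t')) \<or> ?half (s - s') (t - t')"
    using psk by (intro cases[OF _ _ _ _ \<open>(s, t) \<noteq> (s', t')\<close> le(2)]) auto
  note no_two = no_two_short_ratios[of R z M u v, OF trans excl step uv]
  have near_unique: "h = k" if "h \<in> {u, v, u + v}" "k \<in> {u, v, u + v}"
      "2 * cmod (h - z) \<le> M" "2 * cmod (k - z) \<le> M" for h k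
    using that no_two(1-3) by auto
  have near_half: "\<not> 2 * cmod (h - z) \<le> M"
    if "h \<in> {u, v, u + v}" "2 * cmod (1 - cnj (u + v) * z) \<le> M" for h
    using that no_two(4-6) by auto
  have half: "(x - x') * (t - t') = (s - s') * (y - y')"
    if "cnj (u + v) * (x - x') = - (y - y')" "cnj (u + v) * (s - s') = - (t - t')"
  proof -
    have "cnj (u + v) \<noteq> 0" using uv by (auto simp: complex_eq_iff)
    moreover have "cnj (u + v) * ((x - x') * (t - t')) = cnj (u + v) * ((s - s') * (y - y'))"
      using that by algebra
    ultimately show ?thesis by simp
  qed
  have full: "(x - x') * (t - t') = (s - s') * (y - y')"
    if "x - x' = - h * (y - y')" "s - s' = - h * (t - t')" for h
    using that by algebra
  \<comment> \<open>Both differences have the same full ratio or both the half ratio, so the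
    determinant vanishes.\<close>
  show False
    using 1
  proof
    assume "\<exists>h\<in>{u, v, u + v}. ?full h (x - x') (y - y')"
    then obtain h where h: "h \<in> {u, v, u + v}" "?full h (x - x') (y - y')" by blast
    with 2 near_half obtain k where k: "k \<in> {u, v, u + v}" "?full k (s - s') (t - t')" by blast
    with h near_unique have "k = h" by blast
    with full h(2) k(2) nonprop show False by blast
  next
    assume "?half (x - x') (y - y')"
    with 2 near_half half nonprop show False by blast
  qed
qed

section \<open>Optimality of the argmin ratio\<close>

theorem lemma6:
  fixes C :: "complex \<Rightarrow> quad set set"
    and \<gamma> \<theta> :: real
    and z hstar xA xB xA' xB' :: complex
  assumes clusterings: "\<And>h. h \<in> singular_fade_states \<Longrightarrow> clustering (C h) \<and> removes (C h) h"
    and "\<gamma> > 0"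
    and z: "z = of_real \<gamma> * exp (\<i> * of_real \<theta>)"
    and hstar: "hstar = - ((xA - xA') / (xB - xB'))"
    and "hstar \<in> singular_fade_states"
    and argmin: "is_arg_min
       (\<lambda>(uA, uB, uA', uB'). cmod ((uA - uA') + z * (uB - uB')))
       (\<lambda>(uA, uB, uA', uB'). (uA, uB) \<in> psk4 \<times> psk4 \<and> (uA', uB') \<in> psk4 \<times> psk4 \<and>
          (uA, uB) \<noteq> (uA', uB'))
       (xA, xB, xA', xB')"
  shows "is_arg_max (\<lambda>h. dmin_sq (C h) z) (\<lambda>h. h \<in> singular_fade_states) hstar"
proof -
  have "hstar \<noteq> 0"
    using \<open>hstar \<in> singular_fade_states\<close> unfolding singular_fade_states_def fade_state_def by auto
  then have xB: "xB \<noteq> xB'" using hstar by auto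
  have psk: "{xA, xB, xA', xB'} \<subseteq> psk4"
    and min: "\<And>a b a' b'. {a, b, a', b'} \<subseteq> psk4 \<Longrightarrow> (a, b) \<noteq> (a', b') \<Longrightarrow>
      cmod ((xA - xA') + z * (xB - xB')) \<le> cmod ((a - a') + z * (b - b'))"
    using argmin unfolding is_arg_min_linorder by auto
  have C: "clustering (C hstar)" and rem: "removes (C hstar) hstar"
    using clusterings \<open>hstar \<in> singular_fade_states\<close> by blast+
  obtain p q where diff: "different_clusters (C hstar) p q"
    and attained: "dmin_sq (C hstar) z = dist_sq z p q"
    using dmin_sq_attained[OF C] by blast
  obtain a1 b1 a2 b2 a1' b1' a2' b2' where
    pq: "p = ((a1, b1), (a2, b2))" "q = ((a1', b1'), (a2', b2'))"
    by (metis surj_pair)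
  have "p \<in> quads" "q \<in> quads"
    using C diff unfolding clustering_def different_clusters_def partition_on_def by blast+
  then have psk_pq: "{a1, b1, a2, b2, a1', b1', a2', b2'} \<subseteq> psk4"
    by (simp add: pq quads_def)
  \<comment> \<open>Take \<open>M\<close> to be the size of the given difference; the argmin
    difference is no longer. The latter vanishes at \<open>hstar\<close> and the former does not, so
    they are not proportional.\<close>
  have bound: "dmin_sq (C h) z \<le> (cmod ((a - a') + z * (b - b')))\<^sup>2"
    if "h \<in> singular_fade_states" "{a, b, a', b'} \<subseteq> psk4" "(a - a') + hstar * (b - b') \<noteq> 0"
    for h a b a' b'
  proof (rule dmin_sq_le_nonproportional)
    show "clustering (C h)" using clusterings that(1) by blast
    show "cmod ((xA - xA') + z * (xB - xB')) \<le> cmod ((a - a') + z * (b - b'))"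
      using that by (intro min) auto
    have "hstar * (xB - xB') = - (xA - xA')" using xB by (simp add: hstar)
    then have "(xB - xB') * ((a - a') + hstar * (b - b')) =
        (a - a') * (xB - xB') - (xA - xA') * (b - b')"
      by algebra
    then show "(xA - xA') * (b - b') \<noteq> (a - a') * (xB - xB')"
      using that(3) xB by auto
  qed (use psk that in auto)
  have "dmin_sq (C h) z \<le> dmin_sq (C hstar) z" if h: "h \<in> singular_fade_states" for h
  proof -
    \<comment> \<open>The pair attaining the minimum at \<open>z\<close> is now measured at
      \<open>hstar\<close>: removal makes one use nonzero there. Then \<open>bound\<close> applies
      to that use, and the other only adds a square.\<close>
    have "0 < dist_sq hstar p q"
      using rem dmin_sq_le[OF C diff, of hstar] by (simp add: removes_def dmin_def)
    then have "(a1 - a1') + hstar * (b1 - b1') \<noteq> 0 \<or> (a2 - a2') + hstar * (b2 - b2') \<noteq> 0"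
      by (auto simp: pq)
    then have "dmin_sq (C h) z \<le> dist_sq z p q"
    proof
      assume "(a1 - a1') + hstar * (b1 - b1') \<noteq> 0"
      from bound[OF h _ this] psk_pq show ?thesis by (simp add: pq add_increasing2)
    next
      assume "(a2 - a2') + hstar * (b2 - b2') \<noteq> 0"
      from bound[OF h _ this] psk_pq show ?thesis by (simp add: pq add_increasing)
    qed
    with attained show ?thesis by simp
  qed
  then show ?thesis
    using \<open>hstar \<in> singular_fade_states\<close> unfolding is_arg_max_linorder by blast
qed

end
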